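(* Let $n>1$ and let $V=(v_{i,j})$ be a real upper triangular $n\times n$ generator matrix (with nonzero diagonal entries) of the lattice $\Lambda=\{Vu:u\in\mathbb{Z}^n\}$, such that $v_{m,l}/v_{m,m}$ is rational for all $1\le m<l\le n$. Let $\overline{b}=(b_1,\dots,b_n)\in\mathbb{Z}^n$ be the coefficients of the Babai point of $x=(x_1,\dots,x_n)\in\mathbb{R}^n$ with respect to the basis formed by the columns of $V$. Then the coefficients $\overline{b}$ of the Babai point can be determined at the fusion center $F$ after running the transmission protocol $\Pi_c$.
   Context: Setting (centralized model): node $m$ ($m=1,\dots,n$) observes only the coordinate $x_m$ of $x\in\mathbb{R}^n$ and sends information to a fusion center $F$, which is to compute the Babai point of $x$ from the information communicated by the nodes. The matrix $V$ is given. $[z]$ denotes the nearest integer to the real number $z$. Babai point (nearest plane algorithm) for the basis $\{v_1,\dots,v_n\}$ of columns of $V$: let $\mathcal{S}_i$ be the span of $v_1,\dots,v_i$ (with $\mathcal{S}_0=\{0\}$), $\mathcal{P}_i$ the orthogonal projection onto $\mathcal{S}_i$, $v_{i,i-1}^{\mathrm{par}}=\mathcal{P}_{i-1}(v_i)$ and $v_i^{\perp}=v_i-v_{i,i-1}^{\mathrm{par}}$. Set $z_n=x$ and, for $i=n,n-1,\dots,1$, let $b_i=\left[\langle z_i,v_i^{\perp}\rangle/\|v_i^{\perp}\|^2\right]$ and $z_{i-1}=\mathcal{P}_{i-1}(z_i)-b_iv_{i,i-1}^{\mathrm{par}}$. The Babai point is $b_1v_1+\dots+b_nv_n$. For $V$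 upper triangular this amounts to $b_m=\left[\left(x_m-\sum_{l=m+1}^n b_lv_{m,l}\right)/v_{m,m}\right]$, $m=n,n-1,\dots,1$. Protocol $\Pi_c$: for $l>m$ write $v_{m,l}/v_{m,m}=p_{m,l}/q_{m,l}$ with $p_{m,l},q_{m,l}$ relatively prime integers and $q_{m,l}>0$. Let $q_m=\mathrm{lcm}\{q_{m,l}:l>m\}$ for $m<n$, and $q_n=1$ by definition. Let $s(m)$ be the largest $s\in\{0,1,\dots,q_m-1\}$ for which $[x_m/v_{m,m}-s/q_m]=[x_m/v_{m,m}]$ (by definition $s(n)=0$). Node $m$ sends $\tilde b_m=[x_m/v_{m,m}]$ and $s(m)$ to $F$, for $m=1,2,\dots,n$. *)

theory Defs
  imports "HOL-Analysis.Analysis"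
begin

text \<open>
  Vectors and matrices are indexed by a finite linear order \<open>'n\<close>, which plays the role of
  \<open>{1 < \<dots> < n}\<close>. A basis is given by the columns of a matrix, and \<open>[z]\<close> is the library function
  \<^const>\<open>round\<close>, that is \<open>\<lfloor>z + 1/2\<rfloor>\<close>: ties are rounded up.
\<close>

type_synonym 'n rvec = "(real, 'n) vec"
type_synonym 'n rmat = "((real, 'n) vec, 'n) vec"

definition orth_proj :: "'a::real_inner set \<Rightarrow> 'a \<Rightarrow> 'a" where
  "orth_proj S z = (THE y. y \<in> S \<and> (\<forall>w\<in>S. orthogonal (z - y) w))"

definition upper_triangular :: "('n::{finite,linorder}) rmat \<Rightarrow> bool" where
  "upper_triangular V \<longleftrightarrow> (\<forall>i j. j < i \<longrightarrow> V $ i $ j = 0)"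


subsection \<open>Nearest plane algorithm\<close>

text \<open>The span of the columns strictly before \<open>i\<close>, usually written \<open>S\<^bsub>i-1\<^esub>\<close>.\<close>

definition prev_span :: "('n::{finite,linorder}) rmat \<Rightarrow> 'n \<Rightarrow> 'n rvec set" where
  "prev_span V i = span {column j V | j. j < i}"

definition par_part :: "('n::{finite,linorder}) rmat \<Rightarrow> 'n \<Rightarrow> 'n rvec" where
  "par_part V i = orth_proj (prev_span V i) (column i V)"

definition perp_part :: "('n::{finite,linorder}) rmat \<Rightarrow> 'n \<Rightarrow> 'n rvec" where
  "perp_part V i = column i V - par_part V i"

definition np_coeff :: "('n::{finite,linorder}) rmat \<Rightarrow> 'n \<Rightarrow> 'n rvec \<Rightarrow> int" where
  "np_coeff V i z = round ((z \<bullet> perp_part V i) / (norm (perp_part V i))\<^sup>2)"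

text \<open>One step of the algorithm: \<open>z\<^sub>i \<mapsto> z\<^bsub>i-1\<^esub>\<close>.\<close>

definition np_step :: "('n::{finite,linorder}) rmat \<Rightarrow> 'n \<Rightarrow> 'n rvec \<Rightarrow> 'n rvec" where
  "np_step V i z = orth_proj (prev_span V i) z - of_int (np_coeff V i z) *\<^sub>R par_part V i"

text \<open>
  The vector \<open>z\<^sub>i\<close> is obtained from \<open>x\<close> by the steps for all \<open>j > i\<close>, largest \<open>j\<close> first:
  the list is ascending and \<^const>\<open>foldr\<close> starts from its right end. For the largest index
  this gives \<open>x\<close> itself.
\<close>

definition np_vec :: "('n::{finite,linorder}) rmat \<Rightarrow> 'n rvec \<Rightarrow> 'n \<Rightarrow> 'n rvec" where
  "np_vec V x i = foldr (np_step V) (sorted_list_of_set {i<..}) x"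

definition babai_coeffs :: "('n::{finite,linorder}) rmat \<Rightarrow> 'n rvec \<Rightarrow> (int, 'n) vec" where
  "babai_coeffs V x = (\<chi> i. np_coeff V i (np_vec V x i))"


subsection \<open>Transmission protocol\<close>

text \<open>The denominator of a rational number in lowest terms (unspecified for irrational \<open>r\<close>).\<close>

definition lowest_denom :: "real \<Rightarrow> nat" where
  "lowest_denom r = (THE q. q > 0 \<and> (\<exists>p::int. coprime p (int q) \<and> r = of_int p / of_nat q))"

text \<open>For the largest index \<open>m\<close> the set is empty, so \<open>q\<^sub>m = 1\<close> and hence \<open>s(m) = 0\<close> below.\<close>

definition row_denom :: "('n::{finite,linorder}) rmat \<Rightarrow> 'n \<Rightarrow> nat" where
  "row_denom V m = Lcm {lowest_denom (V $ m $ l / V $ m $ m) | l. m < l}"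

text \<open>Everything node \<open>m\<close> computes depends, besides \<open>V\<close>, on its own coordinate \<open>t = x\<^sub>m\<close> only.\<close>

definition node_round :: "('n::{finite,linorder}) rmat \<Rightarrow> 'n \<Rightarrow> real \<Rightarrow> int" where
  "node_round V m t = round (t / V $ m $ m)"

definition node_shift :: "('n::{finite,linorder}) rmat \<Rightarrow> 'n \<Rightarrow> real \<Rightarrow> nat" where
  "node_shift V m t =
     Max {s \<in> {0..<row_denom V m}.
            round (t / V $ m $ m - of_nat s / of_nat (row_denom V m)) = round (t / V $ m $ m)}"

definition node_message :: "('n::{finite,linorder}) rmat \<Rightarrow> 'n \<Rightarrow> real \<Rightarrow> int \<times> nat" where
  "node_message V m t = (node_round V m t, node_shift V m t)"

definition transcript :: "('n::{finite,linorder}) rmat \<Rightarrow> 'n rvec \<Rightarrow> (int \<times> nat, 'n) vec" where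
  "transcript V x = (\<chi> m. node_message V m (x $ m))"

end

theory Submission
  imports Defs
begin

text \<open>
  For upper triangular \<open>V\<close> the nearest plane algorithm is back substitution,
  \<open>b\<^sub>m = [(x\<^sub>m - (\<Sum>l>m. b\<^sub>l v\<^bsub>m,l\<^esub>)) / v\<^bsub>m,m\<^esub>]\<close>. The correction
  \<open>(\<Sum>l>m. b\<^sub>l v\<^bsub>m,l\<^esub>) / v\<^bsub>m,m\<^esub>\<close> is a multiple \<open>p / q\<^sub>m\<close> of \<open>1 / q\<^sub>m\<close>. With
  \<open>p = k q\<^sub>m + r\<close>, \<open>0 \<le> r < q\<^sub>m\<close>, subtracting \<open>p / q\<^sub>m\<close> before rounding lowers the
  rounded value by \<open>k\<close> if \<open>r \<le> s(m)\<close> and by \<open>k + 1\<close> otherwise. So the messages determine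
  the coefficients one after the other, from the largest index downwards.
\<close>

section \<open>Back substitution\<close>

text \<open>Discharges the definite description in \<open>orth_proj\<close>: the difference of two
  candidates lies in \<open>S\<close> and is orthogonal to itself, hence zero.\<close>

lemma orth_proj_eqI:
  assumes S: "subspace S" and "y \<in> S" and "\<And>w. w \<in> S \<Longrightarrow> orthogonal (z - y) w"
  shows "orth_proj S z = y"
  unfolding orth_proj_def
proof (rule the_equality)
  fix y' assume y': "y' \<in> S \<and> (\<forall>w\<in>S. orthogonal (z - y') w)"
  have "y' - y \<in> S" using y' assms by (simp add: subspace_diff)
  then have "(z - y) \<bullet> (y' - y) = 0" "(z - y') \<bullet> (y' - y) = 0"
    using y' assms by (auto simp: orthogonal_def)
  then have "(y' - y) \<bullet> (y' - y) = 0" by (simp add: inner_diff_left)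
  then show "y' = y" by simp
qed (use assms in auto)

text \<open>The coordinate projection that turns out to be
  \<open>orth_proj (prev_span V i)\<close>.\<close>

definition truncate :: "'n::{finite,linorder} \<Rightarrow> 'n rvec \<Rightarrow> 'n rvec" where
  "truncate i z = (\<chi> j. if j < i then z $ j else 0)"

context
  fixes V :: "('n::{finite,linorder}) rmat"
  assumes upper: "upper_triangular V"
    and diag: "\<And>m. V $ m $ m \<noteq> 0"
begin

lemma subspace_prev_span: "subspace (prev_span V i)"
  by (simp add: prev_span_def)

lemma prev_span_vanish:
  assumes "w \<in> prev_span V i" "i \<le> j"
  shows "w $ j = 0"
proof -
  have "prev_span V i \<subseteq> {w. w $ j = 0}"
    unfolding prev_span_def
  proof (rule span_minimal)
    show "subspace {w :: 'n rvec. w $ j = 0}" by (simp add: subspace_def)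
  qed (use \<open>i \<le> j\<close> upper in \<open>auto simp: column_def upper_triangular_def\<close>)
  then show ?thesis using assms by auto
qed

text \<open>Column \<open>j\<close> is a nonzero multiple of \<open>axis j 1\<close> plus a
  combination of earlier unit vectors, so it can be solved for \<open>axis j 1\<close> by induction.
  Together with \<open>prev_span_vanish\<close> this makes \<open>prev_span V i\<close> a coordinate
  subspace.\<close>

lemma axis_in_prev_span: "j < i \<Longrightarrow> axis j 1 \<in> prev_span V i"
proof (induction "card {..<j}" arbitrary: j rule: less_induct)
  case less
  have col: "column j V = (\<Sum>k\<in>UNIV. V $ k $ j *\<^sub>R axis k 1)"
    by (simp add: vec_eq_iff column_def axis_def if_distrib cong: if_cong)
  also have "\<dots> = (\<Sum>k\<in>{..j}. V $ k $ j *\<^sub>R axis k 1)"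
    using upper by (intro sum.mono_neutral_right) (auto simp: upper_triangular_def)
  also have "{..j} = insert j {..<j}" by auto
  finally have "V $ j $ j *\<^sub>R axis j 1 = column j V - (\<Sum>k\<in>{..<j}. V $ k $ j *\<^sub>R axis k 1)"
    by simp
  also have "\<dots> \<in> prev_span V i"
  proof (intro subspace_diff subspace_sum subspace_scale subspace_prev_span)
    show "column j V \<in> prev_span V i"
      using less.prems by (auto simp: prev_span_def intro!: span_base)
    fix k assume "k \<in> {..<j}"
    then show "axis k 1 \<in> prev_span V i"
      using less.prems by (intro less.hyps psubset_card_mono) auto
  qed
  finally have "inverse (V $ j $ j) *\<^sub>R V $ j $ j *\<^sub>R axis j 1 \<in> prev_span V i"
    by (rule subspace_scale[OF subspace_prev_span])
  then show ?case using diag by simp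
qed

lemma orth_proj_prev_span: "orth_proj (prev_span V i) z = truncate i z"
proof (rule orth_proj_eqI[OF subspace_prev_span])
  have "truncate i z = (\<Sum>k\<in>{..<i}. z $ k *\<^sub>R axis k 1)"
    by (simp add: truncate_def vec_eq_iff axis_def if_distrib cong: if_cong)
  also have "\<dots> \<in> prev_span V i"
    by (intro subspace_sum subspace_scale subspace_prev_span axis_in_prev_span) auto
  finally show "truncate i z \<in> prev_span V i" .
  fix w assume "w \<in> prev_span V i"
  then have "w $ j = 0" if "i \<le> j" for j using that by (rule prev_span_vanish)
  then show "orthogonal (z - truncate i z) w"
    by (auto simp: orthogonal_def inner_vec_def truncate_def not_less intro!: sum.neutral)
qed

lemma perp_part_triangular: "perp_part V i = V $ i $ i *\<^sub>R axis i 1"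
  using upper
  by (auto simp: perp_part_def par_part_def orth_proj_prev_span truncate_def vec_eq_iff
      column_def axis_def upper_triangular_def not_less order.strict_iff_order)

lemma np_coeff_triangular: "np_coeff V i z = round (z $ i / V $ i $ i)"
  using diag[of i]
  by (simp add: np_coeff_def perp_part_triangular inner_axis power_mult_distrib
      power2_eq_square)

lemma np_step_triangular:
  "k < i \<Longrightarrow> np_step V i z $ k = z $ k - of_int (np_coeff V i z) * V $ k $ i"
  by (simp add: np_step_def par_part_def orth_proj_prev_span truncate_def column_def)

text \<open>Back substitution reads only the entry \<open>k = i\<close>, but the induction passes
  from \<open>i\<close> to a larger index and so needs the earlier entries too.\<close>

lemma np_vec_triangular:
  "k \<le> i \<Longrightarrow> np_vec V x i $ k = x $ k - (\<Sum>l\<in>{i<..}. of_int (babai_coeffs V x $ l) * V $ k $ l)"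
proof (induction "card {i<..}" arbitrary: i rule: less_induct)
  case less
  show ?case
  proof (cases "{i<..} = {}")
    case True
    then show ?thesis by (simp add: np_vec_def)
  next
    case False
    \<comment> \<open>The head of the ascending list: \<open>foldr\<close> applies the step for
      \<open>j\<close> last.\<close>
    define j where "j = Min {i<..}"
    have j: "i < j" using False Min_in[of "{i<..}"] by (auto simp: j_def)
    have rest: "{i<..} - {j} = {j<..}"
      using j by (auto simp: j_def order.strict_iff_order)
    then have split: "{i<..} = insert j {j<..}" using j by auto
    have "sorted_list_of_set {i<..} = j # sorted_list_of_set {j<..}"
      using sorted_list_of_set_nonempty[OF _ False] rest by (simp add: j_def)
    then have "np_vec V x i = np_step V j (np_vec V x j)" by (simp add: np_vec_def)
    moreover have "np_vec V x j $ k
        = x $ k - (\<Sum>l\<in>{j<..}. of_int (babai_coeffs V x $ l) * V $ k $ l)"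
      using less.prems j by (intro less.hyps psubset_card_mono) auto
    ultimately show ?thesis
      using less.prems j by (simp add: np_step_triangular split babai_coeffs_def)
  qed
qed

lemma babai_coeffs_triangular:
  "babai_coeffs V x $ m =
     round (x $ m / V $ m $ m
            - (\<Sum>l\<in>{m<..}. of_int (babai_coeffs V x $ l) * (V $ m $ l / V $ m $ m)))"
proof -
  have "babai_coeffs V x $ m = round (np_vec V x m $ m / V $ m $ m)"
    by (simp add: babai_coeffs_def np_coeff_triangular)
  then show ?thesis
    by (simp add: np_vec_triangular diff_divide_distrib sum_divide_distrib)
qed

end


section \<open>Rounding after a rational shift\<close>

text \<open>A reduced fraction exists for every rational. Its positive denominator is unique, since
  after cross-multiplying coprimality makes any two such denominators divide each other.\<close>

lemma lowest_denom:
  assumes "r \<in> \<rat>"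
  shows "lowest_denom r > 0 \<and> (\<exists>p::int. coprime p (int (lowest_denom r)) \<and>
           r = of_int p / of_nat (lowest_denom r))"
  unfolding lowest_denom_def
proof (rule theI')
  obtain a b :: int where ab: "b > 0" "coprime a b" "r = of_int a / of_int b"
    using assms by (rule Rats_cases') auto
  show "\<exists>!q. q > 0 \<and> (\<exists>p::int. coprime p (int q) \<and> r = of_int p / of_nat q)"
  proof (rule ex1I)
    show "nat b > 0 \<and> (\<exists>p::int. coprime p (int (nat b)) \<and> r = of_int p / of_nat (nat b))"
      using ab by auto
    fix q assume "q > 0 \<and> (\<exists>p::int. coprime p (int q) \<and> r = of_int p / of_nat q)"
    then obtain p :: int where q: "q > 0" "coprime p (int q)" "r = of_int p / of_nat q"
      by auto
    then have "of_int (p * b) = (of_int (a * int q) :: real)"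
      using ab by (simp add: field_simps)
    then have eq: "p * b = a * int q" by (simp only: of_int_eq_iff)
    then have "int q dvd b" using q(2)
      by (metis coprime_commute coprime_dvd_mult_right_iff dvd_triv_right)
    moreover have "b dvd int q" using ab(2) eq
      by (metis coprime_commute coprime_dvd_mult_right_iff dvd_triv_right)
    ultimately have "int q = b" using ab(1) by (intro zdvd_antisym_nonneg) auto
    then show "q = nat b" by auto
  qed
qed

lemma row_denom_pos:
  assumes "\<And>l. m < l \<Longrightarrow> V $ m $ l / V $ m $ m \<in> \<rat>"
  shows "row_denom V m > 0"
proof -
  let ?A = "{lowest_denom (V $ m $ l / V $ m $ m) | l. m < l}"
  have "0 \<notin> ?A" using lowest_denom[OF assms] by fastforce
  moreover have "Lcm ?A = 0 \<longleftrightarrow> 0 \<in> ?A" by (rule Lcm_0_iff) simp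
  ultimately have "Lcm ?A \<noteq> 0" by (simp only: not_False_eq_True)
  then show ?thesis by (simp only: row_denom_def neq0_conv)
qed

text \<open>One denominator serves the whole row, so integer combinations of the ratios in row
  \<open>m\<close> are multiples of \<open>1 / row_denom V m\<close>.\<close>

lemma row_denom_mult_Ints:
  assumes "V $ m $ l / V $ m $ m \<in> \<rat>" "m < l"
  shows "of_nat (row_denom V m) * (V $ m $ l / V $ m $ m) \<in> \<int>"
proof -
  let ?r = "V $ m $ l / V $ m $ m"
  obtain p :: int where p: "lowest_denom ?r > 0" "?r = of_int p / of_nat (lowest_denom ?r)"
    using lowest_denom[OF assms(1)] by blast
  have "lowest_denom ?r dvd row_denom V m"
    unfolding row_denom_def using assms(2) by (intro dvd_Lcm) auto
  then obtain c where c: "row_denom V m = lowest_denom ?r * c" ..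
  have "of_nat (row_denom V m) * ?r
      = of_nat (lowest_denom ?r * c) * (of_int p / of_nat (lowest_denom ?r))"
    using c p(2) by simp
  also have "\<dots> = of_nat c * of_int p" using p(1) by simp
  finally show ?thesis by simp
qed

lemma round_diff_int: "round (x - of_int k) = round x - k"
  for x :: real
  by (simp add: round_def algebra_simps flip: floor_diff_of_int)

text \<open>As \<open>r\<close> runs through \<open>0, ..., q - 1\<close>,
  \<open>round (t - r / q)\<close> is non-increasing and drops by at most one in total;
  \<open>s\<close> is the last position before a drop.\<close>

lemma round_shift:
  fixes t :: real and p :: int
  assumes q: "q > 0"
    and s: "s = Max {s \<in> {0..<q}. round (t - of_nat s / of_nat q) = round t}"
  shows "round (t - of_int p / of_nat q)
    = round t - p div int q - (if p mod int q \<le> int s then 0 else 1)"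
proof -
  define r where "r = nat (p mod int q)"
  have r: "int r = p mod int q" "r < q" using q by (auto simp: r_def nat_less_iff)
  have "p = (p div int q) * int q + int r" by (simp add: r(1))
  then have "of_int p = of_int (p div int q) * of_nat q + (of_nat r :: real)"
    by (metis of_int_add of_int_mult of_int_of_nat_eq)
  then have "t - of_int p / of_nat q = (t - of_nat r / of_nat q) - of_int (p div int q)"
    using q by (simp add: field_simps)
  then have 1: "round (t - of_int p / of_nat q) = round (t - of_nat r / of_nat q) - p div int q"
    by (simp only: round_diff_int)
  let ?A = "{s \<in> {0..<q}. round (t - of_nat s / of_nat q) = round t}"
  \<comment> \<open>Without a member the \<open>Max\<close> would be unspecified.\<close>
  have "0 \<in> ?A" using q by simp
  then have sA: "s \<in> ?A" unfolding s by (intro Max_in) auto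
  have "round (t - of_nat r / of_nat q) \<le> round t"
    by (intro round_mono) simp
  moreover have "round t - 1 \<le> round (t - of_nat r / of_nat q)"
  proof -
    \<comment> \<open>The remainder shift \<open>r / q\<close> is below 1.\<close>
    have "round (t - of_int 1) \<le> round (t - of_nat r / of_nat q)"
      using r(2) by (intro round_mono) simp
    then show ?thesis by (simp only: round_diff_int)
  qed
  moreover have "round (t - of_nat r / of_nat q) = round t \<longleftrightarrow> r \<le> s"
  proof
    assume "round (t - of_nat r / of_nat q) = round t"
    then show "r \<le> s" unfolding s using r(2) by (intro Max_ge) auto
  next
    assume "r \<le> s"
    \<comment> \<open>Monotonicity squeezes the value at \<open>r\<close> between the value at
      \<open>s\<close> and \<open>round t\<close>, which agree.\<close>
    then have "round (t - of_nat s / of_nat q) \<le> round (t - of_nat r / of_nat q)"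
      by (intro round_mono) (simp add: divide_right_mono)
    then show "round (t - of_nat r / of_nat q) = round t"
      using sA \<open>round (t - of_nat r / of_nat q) \<le> round t\<close> by simp
  qed
  ultimately have "round (t - of_nat r / of_nat q) = round t - (if r \<le> s then 0 else 1)"
    by auto
  with 1 show ?thesis by (simp flip: r(1))
qed

text \<open>The right-hand side of \<open>round_shift\<close> depends on the input only through the
  rounded value and the shift, which are exactly the message.\<close>

lemma round_shift_cong:
  assumes "row_denom V m > 0" and "of_nat (row_denom V m) * c \<in> \<int>"
    and "node_message V m t = node_message V m u"
  shows "round (t / V $ m $ m - c) = round (u / V $ m $ m - c)"
proof -
  obtain p :: int where "of_nat (row_denom V m) * c = of_int p"
    using assms(2) by (rule Ints_cases)
  then have c: "c = of_int p / of_nat (row_denom V m)"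
    using assms(1) by (simp add: field_simps)
  show ?thesis
    using assms(3) unfolding c
    by (simp add: round_shift[OF assms(1) node_shift_def] node_message_def node_round_def)
qed

text \<open>Going down from the largest index, the later coefficients of \<open>x\<close> and
  \<open>y\<close> agree, so both are rounded after the same correction and
  \<open>round_shift_cong\<close> applies.\<close>

lemma babai_coeffs_transcript_cong:
  fixes V :: "('n::{finite,linorder}) rmat"
  assumes upper: "upper_triangular V" and diag: "\<And>m. V $ m $ m \<noteq> 0"
    and rat: "\<And>m l. m < l \<Longrightarrow> V $ m $ l / V $ m $ m \<in> \<rat>"
    and eq: "transcript V x = transcript V y"
  shows "babai_coeffs V x = babai_coeffs V y"
proof -
  have "babai_coeffs V x $ m = babai_coeffs V y $ m" for m
  proof (induction "card {m<..}" arbitrary: m rule: less_induct)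
    case less
    have IH: "babai_coeffs V x $ l = babai_coeffs V y $ l" if "m < l" for l
      using that by (intro less.hyps psubset_card_mono) auto
    let ?c = "\<Sum>l\<in>{m<..}. of_int (babai_coeffs V y $ l) * (V $ m $ l / V $ m $ m)"
    have "of_nat (row_denom V m) * ?c
        = (\<Sum>l\<in>{m<..}. of_int (babai_coeffs V y $ l)
             * (of_nat (row_denom V m) * (V $ m $ l / V $ m $ m)))"
      unfolding sum_distrib_left by (simp only: mult.left_commute)
    also have "\<dots> \<in> \<int>"
      using rat by (intro Ints_sum Ints_mult Ints_of_int row_denom_mult_Ints) auto
    finally have c: "of_nat (row_denom V m) * ?c \<in> \<int>" .
    have "node_message V m (x $ m) = node_message V m (y $ m)"
      using eq by (simp add: transcript_def vec_eq_iff)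
    moreover have "row_denom V m > 0" using rat by (rule row_denom_pos)
    ultimately have "round (x $ m / V $ m $ m - ?c) = round (y $ m / V $ m $ m - ?c)"
      using c by (intro round_shift_cong)
    moreover have
      "?c = (\<Sum>l\<in>{m<..}. of_int (babai_coeffs V x $ l) * (V $ m $ l / V $ m $ m))"
      by (intro sum.cong) (auto simp: IH)
    ultimately show ?case
      using babai_coeffs_triangular[OF upper diag] by metis
  qed
  then show ?thesis by (simp add: vec_eq_iff)
qed

theorem theorem2:
  fixes V :: "('n::{finite,linorder}) rmat"
  assumes "CARD('n) > 1"
    and "upper_triangular V"
    and "\<And>m. V $ m $ m \<noteq> 0"
    and "\<And>m l. m < l \<Longrightarrow> V $ m $ l / V $ m $ m \<in> \<rat>"
  shows "\<exists>decode :: (int \<times> nat, 'n) vec \<Rightarrow> (int, 'n) vec.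
           \<forall>x :: 'n rvec. decode (transcript V x) = babai_coeffs V x"
proof (intro exI allI)
  fix x
  \<comment> \<open>The decoder runs the nearest plane algorithm on an arbitrary input with the
    received transcript; \<open>x\<close> shows that one exists, and the choice does not affect the
    coefficients.\<close>
  have "transcript V (SOME y. transcript V y = transcript V x) = transcript V x"
    by (rule someI) simp
  with assms(2-4) show "(\<lambda>t. babai_coeffs V (SOME y. transcript V y = t)) (transcript V x)
      = babai_coeffs V x"
    by (rule babai_coeffs_transcript_cong)
qed

end
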